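(* Let $n\ge1$. For all $\sigma\in\mathcal{S}_n$, $$C_n^\sigma(t,u)=t^{\mathrm{des}(\sigma)}N_n(t,u),$$ where $C_n^\sigma(t,u)=\sum_{\pi\in\mathcal{C}_n^\sigma}t^{\mathrm{des}(\pi)}u^{\mathrm{plat}(\pi)}$ and $N_n(t,u)=\sum_{D\in\mathcal{D}_n}t^{\mathrm{hpea}(D)}u^{\mathrm{lpea}(D)}$.
   Context: Let $[n]=\{1,\dots,n\}$ and let $[n]\sqcup[n]=\{1,1,2,2,\dots,n,n\}$ be the multiset with two copies of each element of $[n]$. A permutation $\pi=\pi_1\pi_2\dots\pi_{2n}$ of $[n]\sqcup[n]$ is nonnesting if there do not exist $i<j<\ell<m$ with $\pi_i=\pi_m$ and $\pi_j=\pi_\ell$; equivalently, the subsequence of $\pi$ formed by the first (leftmost) copy of each entry coincides with the subsequence formed by the second copy of each entry. $\mathcal{C}_n$ denotes the set of nonnesting permutations of $[n]\sqcup[n]$, and for $\pi\in\mathcal{C}_n$ this common subsequence, a permutation in $\mathcal{S}_n$ (the set of permutations of $[n]$ in one-line notation), is denoted $s(\pi)$. For $\sigma\in\mathcal{S}_n$, $\mathcal{C}_n^\sigma=\{\pi\in\mathcal{C}_n:s(\pi)=\sigma\}$. For a word $\pi=\pi_1\dots\pi_m$ of positive integers, $\mathrm{des}(\pi)=|\{i\in[m-1]:\pi_i>\pi_{i+1}\}|$ and $\mathrm{plat}(\pi)=|\{i\in[m-1]:\pi_i=\pi_{i+1}\}|$. $\mathcal{D}_n$ is the set of Dyck paths: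 lattice paths from $(0,0)$ to $(n,n)$ with steps $\mathtt{e}=(1,0)$ and $\mathtt{n}=(0,1)$ that do not go above the diagonal $y=x$. A peak of $D$ is an occurrence of two adjacent steps $\mathtt{e}\mathtt{n}$; it is a low peak if these steps touch the diagonal (i.e. the $\mathtt{e}$ step starts, equivalently the $\mathtt{n}$ step ends, on $y=x$), and a high peak otherwise. $\mathrm{lpea}(D)$ and $\mathrm{hpea}(D)$ are the numbers of low peaks and high peaks of $D$. *)

theory Defs
  imports "HOL-Combinatorics.Multiset_Permutations"
begin

definition des :: "nat list \<Rightarrow> nat" where
  "des w = card {i. Suc i < length w \<and> w ! i > w ! Suc i}"

definition plat :: "nat list \<Rightarrow> nat" where
  "plat w = card {i. Suc i < length w \<and> w ! i = w ! Suc i}"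

definition nonnesting :: "nat list \<Rightarrow> bool" where
  "nonnesting w \<longleftrightarrow>
     \<not> (\<exists>i j l m. i < j \<and> j < l \<and> l < m \<and> m < length w \<and> w ! i = w ! m \<and> w ! j = w ! l)"

definition nonnesting_perms :: "nat \<Rightarrow> nat list set" where
  "nonnesting_perms n =
     {w \<in> permutations_of_multiset (mset_set {1..n} + mset_set {1..n}). nonnesting w}"

(* The subsequence of leftmost copies. For a nonnesting permutation of the doubled multiset
   the subsequence of second copies is the same word. Note that remdups keeps the
   last copies, not the first. *)
definition first_copies :: "nat list \<Rightarrow> nat list" where
  "first_copies w = nths w {i. w ! i \<notin> set (take i w)}"

definition nonnesting_perms_over :: "nat \<Rightarrow> nat list \<Rightarrow> nat list set" where
  "nonnesting_perms_over n \<sigma> = {w \<in> nonnesting_perms n. first_copies w = \<sigma>}"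

datatype step = East | North

(* The vertex reached after k steps is (xpos D k, ypos D k). *)
definition xpos :: "step list \<Rightarrow> nat \<Rightarrow> nat" where
  "xpos D k = count_list (take k D) East"

definition ypos :: "step list \<Rightarrow> nat \<Rightarrow> nat" where
  "ypos D k = count_list (take k D) North"

definition dyck_paths :: "nat \<Rightarrow> step list set" where
  "dyck_paths n =
     {D. xpos D (length D) = n \<and> ypos D (length D) = n \<and> (\<forall>k\<le>length D. ypos D k \<le> xpos D k)}"

definition peaks :: "step list \<Rightarrow> nat set" where
  "peaks D = {i. Suc i < length D \<and> D ! i = East \<and> D ! Suc i = North}"

definition lpea :: "step list \<Rightarrow> nat" where
  "lpea D = card {i \<in> peaks D. xpos D i = ypos D i}"

definition hpea :: "step list \<Rightarrow> nat" where
  "hpea D = card {i \<in> peaks D. xpos D i \<noteq> ypos D i}"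

(* t and u range over an arbitrary commutative semiring; a polynomial identity in two
   indeterminates is the instance where they are the generators of a polynomial ring
   such as int poly poly. *)
definition C_gf :: "nat \<Rightarrow> nat list \<Rightarrow> 'a \<Rightarrow> 'a \<Rightarrow> 'a::comm_semiring_1" where
  "C_gf n \<sigma> t u = (\<Sum>w\<in>nonnesting_perms_over n \<sigma>. t ^ des w * u ^ plat w)"

definition N_gf :: "nat \<Rightarrow> 'a \<Rightarrow> 'a \<Rightarrow> 'a::comm_semiring_1" where
  "N_gf n t u = (\<Sum>D\<in>dyck_paths n. t ^ hpea D * u ^ lpea D)"

end

theory Submission
  imports Defs
begin

text \<open>Positions of a nonnesting permutation and steps of a Dyck path are both elements of the poset
  \<open>{East < North} \<times> {0..<n}\<close> (first or second copy, index in \<open>\<sigma>\<close>), and both families are its linear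
  extensions. With the labels \<open>0 < 1 < \<dots>\<close> a descent is a high peak and a plateau is a low peak, so it suffices
  to show that the generating function of the linear extensions labelled by \<open>f\<close> depends on \<open>f\<close> only through
  the factor \<open>t\<close> to the number of descents of \<open>f\<close>.
  First, exchanging two consecutive values at nonadjacent indices \<open>p < q\<close> changes nothing, provided that
  the second copy of \<open>p\<close> and the first copy of \<open>q\<close> also trade places whenever they are neighbours; such
  exchanges connect all labellings with the same descent set. Hence, if \<open>k\<close> is a descent, we may assume that
  all labels at indices up to \<open>k\<close> exceed the others. Making them smaller than the others instead
  removes exactly one descent from each word and the descent \<open>k\<close> from \<open>f\<close>.\<close>

section \<open>Linear extensions of the grid\<close>

definition grid_le :: "step \<times> nat \<Rightarrow> step \<times> nat \<Rightarrow> bool" where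
  "grid_le x y \<longleftrightarrow> snd x \<le> snd y \<and> (fst x = East \<or> fst y = North)"

text \<open>Since \<open>grid_le\<close> is reflexive, the condition on pairs of positions also
  rules out repetitions, so no separate distinctness clause appears.\<close>

definition linexts :: "nat \<Rightarrow> (step \<times> nat) list set" where
  "linexts n = {l. set l = UNIV \<times> {..<n} \<and> sorted_wrt (\<lambda>x y. \<not> grid_le y x) l}"

definition consec :: "('b \<Rightarrow> 'b \<Rightarrow> bool) \<Rightarrow> 'b list \<Rightarrow> nat" where
  "consec R l = card {i. Suc i < length l \<and> R (l ! i) (l ! Suc i)}"

text \<open>The exponent of \<open>u\<close> compares indices rather than labels, so it does not
  depend on \<open>f\<close>; for injective labels it counts the plateaus of the labelled
  word.\<close>

definition linext_gf :: "nat \<Rightarrow> (nat \<Rightarrow> nat) \<Rightarrow> 'a \<Rightarrow> 'a \<Rightarrow> 'a::comm_semiring_1" where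
  "linext_gf n f t u =
     (\<Sum>l\<in>linexts n. t ^ consec (\<lambda>x y. f (snd x) > f (snd y)) l * u ^ consec (\<lambda>x y. snd x = snd y) l)"

lemma UNIV_step: "UNIV = {East, North}"
  using step.exhaust by blast

lemma not_East [simp]: "s \<noteq> East \<longleftrightarrow> s = North" and not_North [simp]: "s \<noteq> North \<longleftrightarrow> s = East"
  by (cases s; simp)+

lemma card_grid: "card ((UNIV :: step set) \<times> {..<n}) = 2 * n"
  by (simp add: card_cartesian_product UNIV_step)

lemma consec_cong:
  assumes "length l = length l'"
    and "\<And>i. Suc i < length l \<Longrightarrow> R (l ! i) (l ! Suc i) \<longleftrightarrow> R' (l' ! i) (l' ! Suc i)"
  shows "consec R l = consec R' l'"
  using assms unfolding consec_def by (intro arg_cong[where f = card]) auto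

lemma consec_Nil [simp]: "consec R [] = 0" and consec_single [simp]: "consec R [x] = 0"
  by (simp_all add: consec_def)

lemma consec_Cons [simp]: "consec R (x # y # l) = of_bool (R x y) + consec R (y # l)"
proof -
  let ?A = "{i. Suc i < length (y # l) \<and> R ((y # l) ! i) ((y # l) ! Suc i)}"
  let ?B = "if R x y then {0 :: nat} else {}"
  have eq: "{i. Suc i < length (x # y # l) \<and> R ((x # y # l) ! i) ((x # y # l) ! Suc i)} = ?B \<union> Suc ` ?A"
  proof (rule set_eqI)
    show "i \<in> {i. Suc i < length (x # y # l) \<and> R ((x # y # l) ! i) ((x # y # l) ! Suc i)}
        \<longleftrightarrow> i \<in> ?B \<union> Suc ` ?A" for i
      by (cases i) auto
  qed
  have "card (?B \<union> Suc ` ?A) = card ?B + card (Suc ` ?A)"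
    by (rule card_Un_disjoint) auto
  then show ?thesis
    unfolding consec_def eq by (simp add: card_image)
qed

lemma linextsD:
  assumes "l \<in> linexts n"
  shows "set l = UNIV \<times> {..<n}" "i < j \<Longrightarrow> j < length l \<Longrightarrow> \<not> grid_le (l ! j) (l ! i)"
  using assms by (auto simp: linexts_def sorted_wrt_iff_nth_less)

lemma grid_le_refl [simp]: "grid_le x x"
  by (cases x; cases "fst x") (auto simp: grid_le_def)

lemma linexts_distinct:
  assumes "l \<in> linexts n" shows "distinct l"
proof -
  have "l ! i \<noteq> l ! j" if "i < j" "j < length l" for i j
    using linextsD(2)[OF assms that] by auto
  then show ?thesis
    by (metis distinct_conv_nth nat_neq_iff)
qed

lemma linexts_before:
  assumes "l \<in> linexts n" "i < length l" "j < length l" "grid_le (l ! i) (l ! j)"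
  shows "i \<le> j"
  using linextsD(2)[OF assms(1), of j i] assms by force

text \<open>An element between two neighbours in the poset must also be placed between them in the
  list, where there is no room.\<close>

lemma linexts_cover:
  assumes "l \<in> linexts n" "Suc i < length l" "z \<in> set l" "grid_le (l ! i) z" "grid_le z (l ! Suc i)"
  shows "z = l ! i \<or> z = l ! Suc i"
proof -
  obtain k where k: "k < length l" "z = l ! k"
    using assms(3) by (metis in_set_conv_nth)
  have "i \<le> k" "k \<le> Suc i"
    using linexts_before[OF assms(1)] assms k by auto
  then show ?thesis
    using k le_Suc_eq by force
qed

section \<open>Exchanging consecutive values\<close>

text \<open>Such neighbours must be incomparable: if comparable, then either \<open>p\<close> comes
  first and an element of index \<open>Suc p\<close> would have to stand between them, or
  \<open>q\<close> comes first and the order is violated. The only incomparable choice is the first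
  copy of \<open>q\<close> with the second copy of \<open>p\<close>.\<close>

lemma linexts_consecutive_indices:
  assumes l: "l \<in> linexts n" and i: "Suc i < length l"
    and pq: "Suc p < q" "q < n" and idx: "{snd (l ! i), snd (l ! Suc i)} = {p, q}"
  shows "{l ! i, l ! Suc i} = {(East, q), (North, p)}"
proof -
  have not_le: "\<not> grid_le (l ! Suc i) (l ! i)"
    using linextsD(2)[OF l, of i "Suc i"] i by simp
  have no_between: "z = l ! i \<or> z = l ! Suc i"
    if "grid_le (l ! i) z" "grid_le z (l ! Suc i)" "snd z < n" for z
    using linexts_cover[OF l i _ that(1,2)] that(3) linextsD(1)[OF l] by (cases z) auto
  obtain s a where x: "l ! i = (s, a)" by (cases "l ! i")
  obtain s' b where y: "l ! Suc i = (s', b)" by (cases "l ! Suc i")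
  consider "a = p" "b = q" | "a = q" "b = p"
    using idx x y by (auto simp: doubleton_eq_iff)
  then show ?thesis
  proof cases
    case 1
    have "\<not> (s = East \<or> s' = North)"
      using no_between[of "(s, Suc p)"] no_between[of "(s', Suc p)"] 1 pq x y
      by (cases s; cases s') (auto simp: grid_le_def)
    then show ?thesis
      using 1 x y by auto
  next
    case 2
    then have "\<not> (s' = East \<or> s = North)"
      using not_le x y pq by (auto simp: grid_le_def)
    then show ?thesis
      using 2 x y by auto
  qed
qed

section \<open>Toggling two incomparable neighbours\<close>

definition adjacent :: "'b \<Rightarrow> 'b \<Rightarrow> 'b list \<Rightarrow> bool" where
  "adjacent a b l \<longleftrightarrow> (\<exists>i. Suc i < length l \<and> {l ! i, l ! Suc i} = {a, b})"

text \<open>On a distinct list with \<open>a\<close> and \<open>b\<close> as neighbours the renaming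
  amounts to swapping these two entries. Adjacency ignores their order, which makes the map an
  involution.\<close>

definition toggle :: "'b \<Rightarrow> 'b \<Rightarrow> 'b list \<Rightarrow> 'b list" where
  "toggle a b l = (if adjacent a b l then map (Transposition.transpose a b) l else l)"

lemma adjacent_map_transpose:
  assumes "adjacent a b l" shows "adjacent a b (map (Transposition.transpose a b) l)"
  using assms unfolding adjacent_def by (auto simp: doubleton_eq_iff)

lemma toggle_toggle: "toggle a b (toggle a b l) = l"
  by (simp add: toggle_def adjacent_map_transpose)

lemma length_toggle [simp]: "length (toggle a b l) = length l"
  by (simp add: toggle_def)

text \<open>Swapping two neighbours alters the relative order of no other pair, and the two are
  incomparable.\<close>

lemma toggle_in_linexts:
  assumes l: "l \<in> linexts n" and ab: "\<not> grid_le a b" "\<not> grid_le b a"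
  shows "toggle a b l \<in> linexts n"
proof (cases "adjacent a b l")
  case True
  then obtain i where i: "Suc i < length l" "{l ! i, l ! Suc i} = {a, b}"
    unfolding adjacent_def by auto
  define xs ys x y where d: "xs = take i l" "ys = drop (Suc (Suc i)) l" "x = l ! i" "y = l ! Suc i"
  have l_eq: "l = xs @ x # y # ys"
    using i unfolding d by (metis Cons_nth_drop_Suc Suc_lessD append_take_drop_id)
  have dist: "distinct l" and srt: "sorted_wrt (\<lambda>x y. \<not> grid_le y x) l" and st: "set l = UNIV \<times> {..<n}"
    using linexts_distinct[OF l] l by (auto simp: linexts_def)
  have xy: "{x, y} = {a, b}" using i d by simp
  have tr: "Transposition.transpose a b = Transposition.transpose x y"
    using xy by (auto simp: doubleton_eq_iff transpose_commute)
  have "map (Transposition.transpose x y) zs = zs" if "x \<notin> set zs" "y \<notin> set zs" for zs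
    using that by (intro map_idI) (metis transpose_apply_other)
  then have m: "map (Transposition.transpose a b) l = xs @ y # x # ys"
    using dist unfolding tr unfolding l_eq by auto
  have "\<not> grid_le x y"
    using ab xy by (auto simp: doubleton_eq_iff)
  then have "sorted_wrt (\<lambda>x y. \<not> grid_le y x) (xs @ y # x # ys)"
    using srt unfolding l_eq by (auto simp: sorted_wrt_append)
  moreover have "set (xs @ y # x # ys) = UNIV \<times> {..<n}"
    using st unfolding l_eq by auto
  ultimately show ?thesis
    using True m by (simp add: toggle_def linexts_def)
qed (use l in \<open>simp add: toggle_def\<close>)

text \<open>No third value separates \<open>f p\<close> from \<open>f q\<close>, so \<open>p\<close>
  and \<open>q\<close> compare alike with every other index; exchanging their values can reverse
  only the comparison between the two.\<close>

lemma transpose_consecutive_less_iff: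
  fixes f :: "nat \<Rightarrow> nat"
  assumes fpq: "\<And>r. r < n \<Longrightarrow> r \<noteq> p \<Longrightarrow> r \<noteq> q \<Longrightarrow> (f r < f p \<longleftrightarrow> f r < f q) \<and> (f p < f r \<longleftrightarrow> f q < f r)"
    and rs: "r < n" "s < n" "{r, s} \<noteq> {p, q}"
  shows "(f \<circ> Transposition.transpose p q) r < (f \<circ> Transposition.transpose p q) s \<longleftrightarrow> f r < f s"
proof (cases "r \<in> {p, q}")
  case r: True
  show ?thesis
  proof (cases "s \<in> {p, q}")
    case True
    then have "r = s" using r rs by auto
    then show ?thesis by simp
  next
    case False
    then have "Transposition.transpose p q s = s" by simp
    then show ?thesis
      using r False fpq[OF rs(2)] by (elim insertE) simp_all
  qed
next
  case False
  then have r: "Transposition.transpose p q r = r" by simp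
  show ?thesis
  proof (cases "s \<in> {p, q}")
    case True
    then show ?thesis
      using r False fpq[OF rs(1)] by (elim insertE) simp_all
  next
    case False
    then show ?thesis using r by simp
  qed
qed

text \<open>Toggling \<open>(East, q)\<close> and \<open>(North, p)\<close>, the only elements with
  these indices that can be neighbours, is a bijection that preserves descents and plateaus position
  by position when the labels of \<open>p\<close> and \<open>q\<close> are exchanged at the same
  time.\<close>

lemma linext_gf_swap:
  fixes t u :: "'a::comm_semiring_1"
  assumes pq: "Suc p < q" "q < n"
    and fpq: "\<And>r. r < n \<Longrightarrow> r \<noteq> p \<Longrightarrow> r \<noteq> q \<Longrightarrow> (f r < f p \<longleftrightarrow> f r < f q) \<and> (f p < f r \<longleftrightarrow> f q < f r)"
  shows "linext_gf n (f \<circ> Transposition.transpose p q) t u = linext_gf n f t u"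
proof -
  define a b where ab: "a = (East, q)" "b = (North, p)"
  define f' where "f' = f \<circ> Transposition.transpose p q"
  let ?T = "Transposition.transpose a b"
  have f': "f' p = f q" "f' q = f p" "\<And>r. r \<noteq> p \<Longrightarrow> r \<noteq> q \<Longrightarrow> f' r = f r"
    by (auto simp: f'_def)
  note same = transpose_consecutive_less_iff[of n p q f, OF fpq, folded f'_def]
  have inc: "\<not> grid_le a b" "\<not> grid_le b a"
    using pq by (auto simp: ab grid_le_def)
  have step: "(f' (snd (toggle a b l ! i)) > f' (snd (toggle a b l ! Suc i)) \<longleftrightarrow> f (snd (l ! i)) > f (snd (l ! Suc i)))
      \<and> (snd (toggle a b l ! i) = snd (toggle a b l ! Suc i) \<longleftrightarrow> snd (l ! i) = snd (l ! Suc i))"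
    if l: "l \<in> linexts n" and i: "Suc i < length l" for l i
  proof -
    define x y where xy: "x = l ! i" "y = l ! Suc i"
    have "x \<in> set l" "y \<in> set l" using i xy by auto
    then have n: "snd x < n" "snd y < n"
      using linextsD(1)[OF l] by (metis mem_Times_iff lessThan_iff)+
    have ne: "x \<noteq> y"
      using linexts_distinct[OF l] i by (simp add: xy nth_eq_iff_index_eq)
    have key: "{x, y} = {a, b}" if "{snd x, snd y} = {p, q}"
      using linexts_consecutive_indices[OF l i pq] that by (simp add: xy ab)
    show ?thesis
    proof (cases "adjacent a b l")
      case False
      then have "\<not> {snd x, snd y} = {p, q}"
        using key i xy by (auto simp: adjacent_def)
      then show ?thesis
        using False same[of "snd y" "snd x"] n by (simp add: toggle_def xy[symmetric] insert_commute)
    next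
      case True
      have tog: "toggle a b l ! i = ?T x" "toggle a b l ! Suc i = ?T y"
        using True i by (auto simp: toggle_def xy)
      have key': "{?T x, ?T y} = {a, b}" if "{snd (?T x), snd (?T y)} = {p, q}"
        using linexts_consecutive_indices[OF toggle_in_linexts[OF l inc] _ pq, of i, folded ab] that i
        unfolding tog[symmetric] by simp
      have snd_T: "snd (?T z) = (if z = a then p else if z = b then q else snd z)" for z
        by (auto simp: Transposition.transpose_def ab)
      have T_in: "?T z \<in> {a, b} \<longleftrightarrow> z \<in> {a, b}" for z
        by (auto simp: Transposition.transpose_def)
      consider (both) "x \<in> {a, b}" "y \<in> {a, b}" | (first) "x \<in> {a, b}" "y \<notin> {a, b}"
        | (second) "x \<notin> {a, b}" "y \<in> {a, b}" | (none) "x \<notin> {a, b}" "y \<notin> {a, b}" by blast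
      then show ?thesis
      proof cases
        \<comment> \<open>The two entries trade places and their labels trade values, so the
          comparison reads the same as before.\<close>
        case both
        then show ?thesis
          unfolding tog snd_T xy[symmetric] using ne f' pq by (auto simp: ab)
      next
        case first
        \<comment> \<open>Otherwise the pair has the indices \<open>p\<close> and \<open>q\<close>
          before or after the toggle, and so consists of \<open>a\<close> and \<open>b\<close>; but
          \<open>y\<close> is neither.\<close>
        have "snd y \<notin> {p, q}"
        proof
          assume "snd y \<in> {p, q}"
          then have "{snd x, snd y} = {p, q} \<or> {snd (?T x), snd (?T y)} = {p, q}"
            using first pq by (auto simp: snd_T ab)
          then show False
            using key key' first T_in[of y] by blast
        qed
        then show ?thesis
          unfolding tog snd_T xy[symmetric] using first f' pq fpq[OF n(2)] by (auto simp: ab)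
      next
        case second
        have "snd x \<notin> {p, q}"
        proof
          assume "snd x \<in> {p, q}"
          then have "{snd x, snd y} = {p, q} \<or> {snd (?T x), snd (?T y)} = {p, q}"
            using second pq by (auto simp: snd_T ab)
          then show False
            using key key' second T_in[of x] by blast
        qed
        then show ?thesis
          unfolding tog snd_T xy[symmetric] using second f' pq fpq[OF n(1)] by (auto simp: ab)
      next
        case none
        then have "\<not> {snd x, snd y} = {p, q}"
          using key by blast
        then show ?thesis
          unfolding tog snd_T xy[symmetric]
          using none same[of "snd y" "snd x"] n by (simp add: insert_commute)
      qed
    qed
  qed
  show ?thesis
    unfolding linext_gf_def f'_def[symmetric]
  proof (rule sum.reindex_bij_witness[of _ "toggle a b" "toggle a b"])
    fix l assume l: "l \<in> linexts n"
    \<comment> \<open>Here \<open>step\<close> is used for the toggled list, whose own toggle is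
      \<open>l\<close>.\<close>
    have "consec (\<lambda>x y. f' (snd x) > f' (snd y)) l = consec (\<lambda>x y. f (snd x) > f (snd y)) (toggle a b l)"
      using step[OF toggle_in_linexts[OF l inc]] by (intro consec_cong) (auto simp: toggle_toggle)
    moreover have "consec (\<lambda>x y. snd x = snd y) l = consec (\<lambda>x y. snd x = snd y) (toggle a b l)"
      using step[OF l] by (intro consec_cong) auto
    ultimately show "t ^ consec (\<lambda>x y. f (snd x) > f (snd y)) (toggle a b l) * u ^ consec (\<lambda>x y. snd x = snd y) (toggle a b l)
      = t ^ consec (\<lambda>x y. f' (snd x) > f' (snd y)) l * u ^ consec (\<lambda>x y. snd x = snd y) l"
      by simp
  qed (use toggle_in_linexts[OF _ inc] in \<open>auto simp: toggle_toggle\<close>)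
qed

lemma linext_gf_cong:
  assumes "\<And>i j. i < n \<Longrightarrow> j < n \<Longrightarrow> f i < f j \<longleftrightarrow> g i < g j"
  shows "linext_gf n f t u = linext_gf n g t u"
proof -
  have "consec (\<lambda>x y. f (snd x) > f (snd y)) l = consec (\<lambda>x y. g (snd x) > g (snd y)) l"
    if "l \<in> linexts n" for l
    using linextsD(1)[OF that] assms
    by (intro consec_cong) (auto simp: set_eq_iff in_set_conv_nth, (metis Suc_lessD prod.collapse)+)
  then show ?thesis
    unfolding linext_gf_def by (intro sum.cong) auto
qed

text \<open>Induction on the number of index pairs that \<open>f\<close> and \<open>g\<close> order
  differently. Among these, a pair with the smallest gap in \<open>f\<close> has consecutive values
  and nonadjacent indices, so exchanging its values keeps the generating function and settles this
  pair without disturbing any other. With no such pair left, \<open>f\<close> and \<open>g\<close>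
  are order isomorphic.\<close>

lemma linext_gf_same_descents:
  fixes t u :: "'a::comm_semiring_1"
  assumes "inj_on f {..<n}" "inj_on g {..<n}"
    and "\<And>k. Suc k < n \<Longrightarrow> f k > f (Suc k) \<longleftrightarrow> g k > g (Suc k)"
  shows "linext_gf n f t u = linext_gf n g t u"
proof -
  define dis where "dis f = {(p, q). p < n \<and> q < n \<and> f p < f q \<and> g q < g p}" for f :: "nat \<Rightarrow> nat"
  have fin: "finite (dis f)" for f
    by (rule finite_subset[of _ "{..<n} \<times> {..<n}"]) (auto simp: dis_def)
  have "linext_gf n f t u = linext_gf n g t u"
    if "inj_on f {..<n}" "\<And>k. Suc k < n \<Longrightarrow> f k > f (Suc k) \<longleftrightarrow> g k > g (Suc k)" for f
    using that
  proof (induction "card (dis f)" arbitrary: f rule: less_induct)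
    case less
    note injf = less.prems(1) and desc = less.prems(2)
    show ?case
    proof (cases "dis f = {}")
      case True
      have "f i < f j \<longleftrightarrow> g i < g j" if "i < n" "j < n" for i j
        using True that inj_onD[OF injf, of i j] inj_onD[OF assms(2), of i j]
        unfolding dis_def by (cases "i = j") (auto, metis nat_neq_iff, metis nat_neq_iff)
      then show ?thesis
        by (rule linext_gf_cong)
    next
      case False
      obtain p q where pq: "(p, q) \<in> dis f"
        and minimal: "\<And>r s. (r, s) \<in> dis f \<Longrightarrow> f q - f p \<le> f s - f r"
        using ex_has_least_nat[of "\<lambda>x. x \<in> dis f" _ "\<lambda>(p, q). f q - f p"] False by fastforce
      have pq': "p < n" "q < n" "f p < f q" "g q < g p"
        using pq by (auto simp: dis_def)
      \<comment> \<open>If \<open>f r\<close> lay strictly between, then wherever \<open>g r\<close>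
        falls, \<open>r\<close> would form with \<open>p\<close> or with \<open>q\<close> a
        discordant pair of smaller gap.\<close>
      have gap: "\<not> (f p < f r \<and> f r < f q)" if "r < n" for r
      proof
        assume r: "f p < f r \<and> f r < f q"
        have "(p, r) \<in> dis f \<or> (r, q) \<in> dis f"
          using r pq' that by (auto simp: dis_def)
        then show False
          using minimal[of p r] minimal[of r q] r by auto
      qed
      have ne: "f r \<noteq> f p" "f r \<noteq> f q" if "r < n" "r \<noteq> p" "r \<noteq> q" for r
        using inj_onD[OF injf] that pq' by auto
      have cons: "(f r < f p \<longleftrightarrow> f r < f q) \<and> (f p < f r \<longleftrightarrow> f q < f r)" if "r < n" "r \<noteq> p" "r \<noteq> q" for r
        using gap[OF that(1)] ne[OF that] pq'(3) by linarith
      define f' where "f' = f \<circ> Transposition.transpose p q"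
      have f': "f' p = f q" "f' q = f p" "\<And>r. r \<noteq> p \<Longrightarrow> r \<noteq> q \<Longrightarrow> f' r = f r"
        by (auto simp: f'_def)
      \<comment> \<open>At adjacent indices \<open>f\<close> and \<open>g\<close> agree by the
        equality of descents, so a discordant pair is never adjacent.\<close>
      have far: "q \<noteq> Suc p" "p \<noteq> Suc q" "p \<noteq> q"
        using desc[of p] desc[of q] pq' by auto
      have swap: "linext_gf n f' t u = linext_gf n f t u"
      proof (cases "p < q")
        case True
        then show ?thesis
          unfolding f'_def using far pq' cons by (intro linext_gf_swap) auto
      next
        case False
        then show ?thesis
          unfolding f'_def transpose_commute[of p q] using far pq' cons
          by (intro linext_gf_swap) auto
      qed
      have same: "f' r < f' s \<longleftrightarrow> f r < f s" if "r < n" "s < n" "{r, s} \<noteq> {p, q}" for r s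
        unfolding f'_def by (rule transpose_consecutive_less_iff[OF cons that])
      have "dis f' \<subset> dis f"
      proof
        show "dis f' \<subseteq> dis f"
        proof
          fix x assume "x \<in> dis f'"
          then obtain r s where x: "x = (r, s)" "r < n" "s < n" "f' r < f' s" "g s < g r"
            by (auto simp: dis_def)
          have "{r, s} \<noteq> {p, q}"
            using x pq' f' by (auto simp: doubleton_eq_iff)
          then show "x \<in> dis f"
            using x same[of r s] by (auto simp: dis_def)
        qed
        have "(p, q) \<notin> dis f'"
          using f' pq' by (simp add: dis_def)
        then show "dis f' \<noteq> dis f"
          using pq by blast
      qed
      then have "card (dis f') < card (dis f)"
        using fin psubset_card_mono by blast
      moreover have "inj_on f' {..<n}"
        unfolding f'_def using injf pq' by (intro comp_inj_on) (auto simp: transpose_image_eq)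
      moreover have "f' k > f' (Suc k) \<longleftrightarrow> g k > g (Suc k)" if "Suc k < n" for k
        using desc[OF that] same[of "Suc k" k] that far by (auto simp only: doubleton_eq_iff Suc_lessD)
      ultimately show ?thesis
        using less.hyps[of f'] swap by simp
    qed
  qed
  then show ?thesis
    using assms by blast
qed

section \<open>Rotating the values across a descent\<close>

text \<open>\<open>(East, 0)\<close> is the least element of the grid and hence comes first.\<close>

lemma linexts_hd:
  assumes "l \<in> linexts n" "n > 0" shows "l \<noteq> []" "snd (hd l) = 0"
proof -
  have 1: "(East, 0) \<in> set l"
    using linextsD(1)[OF assms(1)] assms(2) by auto
  then show "l \<noteq> []" by auto
  obtain i where i: "i < length l" "l ! i = (East, 0)"
    using 1 by (metis in_set_conv_nth)
  have "i = 0"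
    using linextsD(2)[OF assms(1), of 0 i] i by (cases i) (auto simp: grid_le_def)
  then show "snd (hd l) = 0"
    using i \<open>l \<noteq> []\<close> by (simp add: hd_conv_nth)
qed

text \<open>\<open>(North, n - 1)\<close> is the greatest element of the grid and hence comes
  last.\<close>

lemma linexts_last:
  assumes "l \<in> linexts n" "n > 0" shows "snd (last l) = n - 1"
proof -
  have 1: "(North, n - 1) \<in> set l"
    using linextsD(1)[OF assms(1)] assms(2) by auto
  then have "l \<noteq> []" by auto
  obtain i where i: "i < length l" "l ! i = (North, n - 1)"
    using 1 by (metis in_set_conv_nth)
  have "snd (last l) < n"
    using last_in_set[OF \<open>l \<noteq> []\<close>] linextsD(1)[OF assms(1)] by (metis mem_Times_iff lessThan_iff)
  then have "grid_le (l ! (length l - 1)) (l ! i)"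
    using i \<open>l \<noteq> []\<close> by (simp add: grid_le_def last_conv_nth)
  then have "length l - 1 \<le> i"
    using linexts_before[OF assms(1)] i \<open>l \<noteq> []\<close> by simp
  then have "i = length l - 1"
    using i by simp
  then show ?thesis
    using i \<open>l \<noteq> []\<close> by (simp add: last_conv_nth)
qed

text \<open>Comparisons inside \<open>P\<close> or inside its complement are the same on both sides.
  Raising \<open>P\<close> makes each exit from \<open>P\<close> a descent and each entry an ascent;
  raising the complement does the reverse. Exits minus entries is determined by the two ends of the
  list.\<close>

lemma consec_raise_exchange:
  fixes f :: "'b \<Rightarrow> nat"
  assumes "l \<noteq> []" "\<forall>x\<in>set l. f x < M"
  shows "consec (\<lambda>x y. f x + M * of_bool (P x) > f y + M * of_bool (P y)) l + of_bool (P (last l))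
       = consec (\<lambda>x y. f x + M * of_bool (\<not> P x) > f y + M * of_bool (\<not> P y)) l + of_bool (P (hd l))"
  using assms
proof (induction l rule: induct_list012)
  case (3 x y zs)
  then show ?case
    by (cases "P x"; cases "P y") auto
qed auto

lemma inj_on_raise:
  fixes f :: "'b \<Rightarrow> nat"
  assumes "inj_on f A" "\<And>i. i \<in> A \<Longrightarrow> f i < M"
  shows "inj_on (\<lambda>i. f i + M * of_bool (P i)) A"
proof (rule inj_onI)
  fix i j assume ij: "i \<in> A" "j \<in> A" "f i + M * of_bool (P i) = f j + M * of_bool (P j)"
  then have "f i = f j"
    using assms(2)[of i] assms(2)[of j] by (cases "P i"; cases "P j") auto
  then show "i = j"
    using assms(1) ij by (auto dest: inj_onD)
qed

text \<open>Every linear extension starts with an index below \<open>k\<close> and ends with one that is not, so it crosses from the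
  first block of indices to the second exactly once more than back.\<close>

lemma linext_gf_raise_exchange:
  fixes t u :: "'a::comm_semiring_1"
  assumes k: "0 < k" "k < n" and M: "\<And>i. i < n \<Longrightarrow> f i < M"
  shows "linext_gf n (\<lambda>i. f i + M * of_bool (i < k)) t u = t * linext_gf n (\<lambda>i. f i + M * of_bool (\<not> i < k)) t u"
proof -
  have "consec (\<lambda>x y. f (snd x) + M * of_bool (snd x < k) > f (snd y) + M * of_bool (snd y < k)) l
      = Suc (consec (\<lambda>x y. f (snd x) + M * of_bool (\<not> snd x < k) > f (snd y) + M * of_bool (\<not> snd y < k)) l)"
    if l: "l \<in> linexts n" for l
  proof -
    have "\<forall>x\<in>set l. (f \<circ> snd) x < M"
      using linextsD(1)[OF l] M by auto
    moreover have "l \<noteq> []" "snd (hd l) < k" "\<not> snd (last l) < k"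
      using linexts_hd[OF l] linexts_last[OF l] k by auto
    ultimately show ?thesis
      using consec_raise_exchange[of l "f \<circ> snd" M "\<lambda>x. snd x < k"] by (simp only: comp_def) simp
  qed
  then show ?thesis
    unfolding linext_gf_def sum_distrib_left by (intro sum.cong) (auto simp: mult.assoc)
qed

section \<open>Removing the descents one at a time\<close>

definition descents :: "nat \<Rightarrow> (nat \<Rightarrow> nat) \<Rightarrow> nat set" where
  "descents n f = {k. Suc k < n \<and> f k > f (Suc k)}"

lemma linext_gf_descents:
  fixes t u :: "'a::comm_semiring_1"
  assumes "inj_on f {..<n}"
  shows "linext_gf n f t u = t ^ card (descents n f) * linext_gf n id t u"
  using assms
proof (induction "card (descents n f)" arbitrary: f)
  case 0
  have "finite (descents n f)"
    by (rule finite_subset[of _ "{..<n}"]) (auto simp: descents_def)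
  then have "descents n f = {}"
    using 0 by simp
  then have "linext_gf n f t u = linext_gf n id t u"
    using 0 by (intro linext_gf_same_descents) (auto simp: descents_def)
  then show ?case
    by (simp add: \<open>descents n f = {}\<close> del: id_apply)
next
  case (Suc d)
  then obtain k where k: "k \<in> descents n f"
    by fastforce
  \<comment> \<open>A shift by more than the largest label puts the raised block entirely above the
    other one.\<close>
  define M where "M = Suc (Max (f ` {..<n}))"
  have M: "f i < M" if "i < n" for i
    using that by (auto simp: M_def less_Suc_eq_le)
  define g where "g = (\<lambda>i. f i + M * of_bool (i < Suc k))"
  define h where "h = (\<lambda>i. f i + M * of_bool (\<not> i < Suc k))"
  have inj: "inj_on g {..<n}" "inj_on h {..<n}"
    unfolding g_def h_def using Suc.prems by (intro inj_on_raise; use M in auto)+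
  \<comment> \<open>Raising the indices up to \<open>k\<close> affects only the comparison at
    \<open>k\<close>, and there a descent stays a descent.\<close>
  have "linext_gf n f t u = linext_gf n g t u"
    using k M by (intro linext_gf_same_descents Suc.prems inj) (auto simp: g_def descents_def trans_less_add2 less_Suc_eq)
  also have "\<dots> = t * linext_gf n h t u"
    unfolding g_def h_def using k M by (intro linext_gf_raise_exchange) (auto simp: descents_def)
  \<comment> \<open>Raising the indices after \<open>k\<close> instead turns \<open>k\<close> into
    an ascent and leaves the other adjacent comparisons alone.\<close>
  also have "descents n h = descents n f - {k}"
    using k M[of k] M[of "Suc k"] by (auto simp: descents_def h_def less_Suc_eq trans_less_add2)
  then have "card (descents n h) = d"
    using Suc.hyps(2) k by simp
  then have "linext_gf n h t u = t ^ d * linext_gf n id t u"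
    using Suc.hyps(1)[of h] inj by simp
  finally show ?case
    by (simp add: Suc.hyps(2)[symmetric] mult.assoc)
qed

section \<open>Linear extensions as Dyck paths\<close>

lemma xpos_0 [simp]: "xpos D 0 = 0" and ypos_0 [simp]: "ypos D 0 = 0"
  by (simp_all add: xpos_def ypos_def)

lemma xpos_Suc: "k < length D \<Longrightarrow> xpos D (Suc k) = xpos D k + of_bool (D ! k = East)"
  and ypos_Suc: "k < length D \<Longrightarrow> ypos D (Suc k) = ypos D k + of_bool (D ! k = North)"
  by (simp_all add: xpos_def ypos_def take_Suc_conv_app_nth)

lemma xpos_mono: "i \<le> j \<Longrightarrow> xpos D i \<le> xpos D j"
  and ypos_mono: "i \<le> j \<Longrightarrow> ypos D i \<le> ypos D j"
  unfolding xpos_def ypos_def by (metis count_list_append le_add1 le_add_diff_inverse take_add)+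

lemma xpos_less: "i < j \<Longrightarrow> j \<le> length D \<Longrightarrow> D ! i = East \<Longrightarrow> xpos D i < xpos D j"
  using xpos_mono[of "Suc i" j D] by (simp add: xpos_Suc)

lemma ypos_less: "i < j \<Longrightarrow> j \<le> length D \<Longrightarrow> D ! i = North \<Longrightarrow> ypos D i < ypos D j"
  using ypos_mono[of "Suc i" j D] by (simp add: ypos_Suc)

lemma length_eq_count_steps: "length D = count_list D East + count_list D North"
  by (induction D) auto

lemma dyck_pathsD:
  assumes "D \<in> dyck_paths n"
  shows "length D = 2 * n" "xpos D (length D) = n" "ypos D (length D) = n"
    and "k \<le> length D \<Longrightarrow> ypos D k \<le> xpos D k"
  using assms length_eq_count_steps[of D] by (auto simp: dyck_paths_def xpos_def ypos_def)

text \<open>The rank, counted from 0, of step \<open>i\<close> among the steps of its own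
  kind.\<close>

definition step_index :: "step list \<Rightarrow> nat \<Rightarrow> nat" where
  "step_index D i = (if D ! i = East then xpos D i else ypos D i)"

definition tag :: "step list \<Rightarrow> (step \<times> nat) list" where
  "tag D = map (\<lambda>i. (D ! i, step_index D i)) [0..<length D]"

lemma length_tag [simp]: "length (tag D) = length D"
  by (simp add: tag_def)

lemma nth_tag [simp]: "i < length D \<Longrightarrow> tag D ! i = (D ! i, step_index D i)"
  by (simp add: tag_def)

lemma map_fst_tag: "map fst (tag D) = D"
  by (rule nth_equalityI) auto

text \<open>The order condition forces distinct entries, and \<open>2 * n\<close> distinct entries
  fill a grid of that size.\<close>

lemma linextsI:
  assumes len: "length l = 2 * n" and sub: "set l \<subseteq> UNIV \<times> {..<n}"
    and srt: "\<And>i j. i < j \<Longrightarrow> j < length l \<Longrightarrow> \<not> grid_le (l ! j) (l ! i)"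
  shows "l \<in> linexts n"
proof -
  have "l ! i \<noteq> l ! j" if "i < j" "j < length l" for i j
    using srt[OF that] by auto
  then have "distinct l"
    by (metis distinct_conv_nth nat_neq_iff)
  then have "set l = UNIV \<times> {..<n}"
    using len sub by (intro card_subset_eq) (auto simp: distinct_card card_grid finite_subset UNIV_step)
  then show ?thesis
    using srt by (auto simp: linexts_def sorted_wrt_iff_nth_less)
qed

text \<open>Indices increase along the steps of one kind. The Dyck condition enters for a North step
  \<open>i\<close> before an East step \<open>j\<close>: \<open>ypos D i < ypos D j\<close> and
  \<open>ypos D j \<le> xpos D j\<close>.\<close>

lemma tag_in_linexts:
  assumes "D \<in> dyck_paths n"
  shows "tag D \<in> linexts n"
proof (rule linextsI)
  note D = dyck_pathsD[OF assms]
  have "step_index D i < n" if "i < length D" for i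
    using xpos_less[of i "length D" D] ypos_less[of i "length D" D] that D(2,3)
    by (cases "D ! i") (auto simp: step_index_def)
  then show "set (tag D) \<subseteq> UNIV \<times> {..<n}"
    by (auto simp: tag_def)
  show "length (tag D) = 2 * n"
    using D by simp
  fix i j assume ij: "i < j" "j < length (tag D)"
  show "\<not> grid_le (tag D ! j) (tag D ! i)"
    using ij xpos_less[of i j D] ypos_less[of i j D] D(4)[of j]
    by (cases "D ! i"; cases "D ! j") (auto simp: grid_le_def step_index_def)
qed

section \<open>From linear extensions back to paths\<close>

lemma count_list_map_fst:
  "distinct l \<Longrightarrow> count_list (map fst l) s = card {k. (s, k) \<in> set l}"
proof (induction l)
  case (Cons x l)
  obtain s' m where x: "x = (s', m)" by (cases x)
  have fin: "finite {k. (s, k) \<in> set l}"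
    by (rule finite_subset[of _ "snd ` set l"]) force+
  show ?case
  proof (cases "s' = s")
    case True
    then have "{k. (s, k) \<in> set (x # l)} = insert m {k. (s, k) \<in> set l}"
      using x by auto
    then show ?thesis
      using Cons fin x True by simp
  next
    case False
    then have "{k. (s, k) \<in> set (x # l)} = {k. (s, k) \<in> set l}"
      using x by auto
    then show ?thesis
      using Cons x False by simp
  qed
qed auto

lemma pos_map_fst:
  assumes "l \<in> linexts n"
  shows "xpos (map fst l) k = card {m. (East, m) \<in> set (take k l)}"
    and "ypos (map fst l) k = card {m. (North, m) \<in> set (take k l)}"
  using linexts_distinct[OF assms] count_list_map_fst[of "take k l"]
  by (simp_all add: xpos_def ypos_def take_map)

lemma nth_in_set_take: "i < k \<Longrightarrow> i < length l \<Longrightarrow> l ! i \<in> set (take k l)"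
  by (metis in_set_conv_nth length_take min_less_iff_conj nth_take)

lemma linexts_position:
  assumes "l \<in> linexts n" "m < n"
  obtains j where "j < length l" "l ! j = (s, m)"
  using linextsD(1)[OF assms(1)] assms(2) by (metis SigmaI UNIV_I in_set_conv_nth lessThan_iff)

text \<open>The elements of one kind form a chain, so a linear extension lists them by increasing
  index. This lets \<open>tag\<close> recover an index by counting earlier steps.\<close>

lemma linexts_take_same_step:
  assumes l: "l \<in> linexts n" and i: "i < length l" "l ! i = (s, k)"
  shows "{m. (s, m) \<in> set (take i l)} = {..<k}"
proof (intro set_eqI iffI)
  fix m assume "m \<in> {m. (s, m) \<in> set (take i l)}"
  then obtain j where "j < i" "l ! j = (s, m)"
    by (auto simp: in_set_conv_nth)
  then show "m \<in> {..<k}"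
    using linextsD(2)[OF l, of j i] i by (cases s) (auto simp: grid_le_def)
next
  fix m assume m: "m \<in> {..<k}"
  have "(s, k) \<in> set l" using i by (metis nth_mem)
  then have "k < n" using linextsD(1)[OF l] by auto
  then obtain j where j: "j < length l" "l ! j = (s, m)"
    using linexts_position[OF l, of m s] m by auto
  have "j \<le> i"
    by (rule linexts_before[OF l j(1) i(1)]) (use m j i in \<open>cases s; simp add: grid_le_def\<close>)
  then have "j < i" using i j m by (cases "i = j") auto
  then show "m \<in> {m. (s, m) \<in> set (take i l)}"
    using j nth_in_set_take[of j i l] by simp
qed

lemma tag_map_fst:
  assumes "l \<in> linexts n" shows "tag (map fst l) = l"
proof (rule nth_equalityI)
  fix i assume "i < length (tag (map fst l))"
  then have i: "i < length l" by simp
  obtain s k where sk: "l ! i = (s, k)" by (cases "l ! i")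
  show "tag (map fst l) ! i = l ! i"
    using i sk linexts_take_same_step[OF assms i sk] pos_map_fst[OF assms, of i]
    by (cases s) (auto simp: step_index_def)
qed simp

lemma linexts_East_before_North:
  assumes l: "l \<in> linexts n" and "i < length l" "l ! i = (North, k)"
  obtains j where "j < i" "l ! j = (East, k)"
proof -
  have "(North, k) \<in> set l" using assms by (metis nth_mem)
  then have "k < n" using linextsD(1)[OF l] by auto
  then obtain j where j: "j < length l" "l ! j = (East, k)"
    using linexts_position[OF l] by blast
  then have "j \<le> i" "j \<noteq> i"
    using linexts_before[OF l, of j i] assms by (auto simp: grid_le_def)
  then show ?thesis
    using that[of j] j by simp
qed

text \<open>Each \<open>(North, m)\<close> comes after \<open>(East, m)\<close>, so in every prefix
  the North indices form a subset of the East indices.\<close>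

lemma map_fst_in_dyck_paths:
  assumes l: "l \<in> linexts n" shows "map fst l \<in> dyck_paths n"
proof -
  have "{m. (s, m) \<in> set l} = {..<n}" for s
    using linextsD(1)[OF l] by auto
  then have "xpos (map fst l) (length l) = n" "ypos (map fst l) (length l) = n"
    by (simp_all add: pos_map_fst[OF l])
  moreover have "ypos (map fst l) k \<le> xpos (map fst l) k" for k
    unfolding pos_map_fst[OF l]
  proof (rule card_mono)
    show "finite {m. (East, m) \<in> set (take k l)}"
      by (rule finite_subset[of _ "snd ` set (take k l)"]) force+
    show "{m. (North, m) \<in> set (take k l)} \<subseteq> {m. (East, m) \<in> set (take k l)}"
    proof
      fix m assume "m \<in> {m. (North, m) \<in> set (take k l)}"
      then obtain i where i: "i < k" "i < length l" "l ! i = (North, m)"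
        by (auto simp: in_set_conv_nth)
      obtain j where "j < i" "l ! j = (East, m)"
        using linexts_East_before_North[OF l i(2,3)] .
      then show "m \<in> {m. (East, m) \<in> set (take k l)}"
        using i nth_in_set_take[of j k l] by simp
    qed
  qed
  ultimately show ?thesis
    by (simp add: dyck_paths_def)
qed

text \<open>The index grows by one along two equal steps, and it grows at a valley because the path
  stays weakly below the diagonal. At a peak the comparison is between \<open>xpos D i\<close> and
  \<open>ypos D i\<close>, which tells high from low.\<close>

lemma dyck_paths_consecutive_index:
  assumes D: "D \<in> dyck_paths n" and i: "Suc i < length D"
  shows "step_index D i > step_index D (Suc i) \<longleftrightarrow> i \<in> peaks D \<and> xpos D i \<noteq> ypos D i"
    and "step_index D i = step_index D (Suc i) \<longleftrightarrow> i \<in> peaks D \<and> xpos D i = ypos D i"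
  using dyck_pathsD(4)[OF D, of i] dyck_pathsD(4)[OF D, of "Suc i"] i
  by (cases "D ! i"; cases "D ! Suc i"; auto simp: step_index_def peaks_def xpos_Suc ypos_Suc)+

lemma N_gf_eq_linext_gf: "N_gf n t u = linext_gf n id t u"
  unfolding N_gf_def linext_gf_def
proof (rule sum.reindex_bij_witness[of _ "map fst" tag])
  fix D assume D: "D \<in> dyck_paths n"
  have "consec (\<lambda>x y. id (snd x) > id (snd y)) (tag D) = hpea D"
    unfolding consec_def hpea_def using dyck_paths_consecutive_index(1)[OF D]
    by (intro arg_cong[where f = card]) (auto simp: peaks_def)
  moreover have "consec (\<lambda>x y. snd x = snd y) (tag D) = lpea D"
    unfolding consec_def lpea_def using dyck_paths_consecutive_index(2)[OF D]
    by (intro arg_cong[where f = card]) (auto simp: peaks_def)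
  ultimately show "t ^ consec (\<lambda>x y. id (snd x) > id (snd y)) (tag D) * u ^ consec (\<lambda>x y. snd x = snd y) (tag D)
      = t ^ hpea D * u ^ lpea D"
    by simp
qed (auto simp: map_fst_tag tag_map_fst tag_in_linexts map_fst_in_dyck_paths)

section \<open>Linear extensions as nonnesting permutations\<close>

definition label_word :: "nat list \<Rightarrow> (step \<times> nat) list \<Rightarrow> nat list" where
  "label_word \<sigma> l = map (\<lambda>x. \<sigma> ! snd x) l"

text \<open>Meant as the inverse of \<open>label_word\<close>: a repeated letter is tagged
  \<open>North\<close>, and \<open>inv_into\<close> finds the position of the letter in
  \<sigma>.\<close>

definition tag_word :: "nat list \<Rightarrow> nat list \<Rightarrow> (step \<times> nat) list" where
  "tag_word \<sigma> w = map (\<lambda>i. (if w ! i \<in> set (take i w) then North else East,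
     inv_into {..<length \<sigma>} ((!) \<sigma>) (w ! i))) [0..<length w]"

lemma linexts_first_occurrence_iff:
  assumes l: "l \<in> linexts n" and i: "i < length l"
  shows "snd (l ! i) \<in> set (map snd (take i l)) \<longleftrightarrow> fst (l ! i) = North"
proof
  assume "snd (l ! i) \<in> set (map snd (take i l))"
  then obtain j where "j < i" "snd (l ! j) = snd (l ! i)"
    by (auto simp: in_set_conv_nth)
  then show "fst (l ! i) = North"
    using linextsD(2)[OF l, of j i] i by (cases "fst (l ! i)") (auto simp: grid_le_def)
next
  assume "fst (l ! i) = North"
  then obtain j where "j < i" "l ! j = (East, snd (l ! i))"
    using linexts_East_before_North[OF l i] by (metis prod.collapse)
  then have "(East, snd (l ! i)) \<in> set (take i l)"
    using i nth_in_set_take[of j i l] by simp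
  then show "snd (l ! i) \<in> set (map snd (take i l))"
    by (metis image_eqI list.set_map snd_conv)
qed

lemma label_word_first_iff:
  assumes l: "l \<in> linexts n" and \<sigma>: "distinct \<sigma>" "length \<sigma> = n" and i: "i < length l"
  shows "label_word \<sigma> l ! i \<in> set (take i (label_word \<sigma> l)) \<longleftrightarrow> fst (l ! i) = North"
proof -
  have sub: "snd ` set l \<subseteq> {..<n}"
    using linextsD(1)[OF l] by auto
  have "inj_on ((!) \<sigma>) {..<n}"
    using \<sigma> by (auto simp: inj_on_def nth_eq_iff_index_eq)
  then have "\<sigma> ! snd (l ! i) \<in> (!) \<sigma> ` (snd ` set (take i l)) \<longleftrightarrow> snd (l ! i) \<in> snd ` set (take i l)"
  proof (rule inj_on_image_mem_iff)
    show "snd (l ! i) \<in> {..<n}"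
      using sub nth_mem[OF i] by blast
    show "snd ` set (take i l) \<subseteq> {..<n}"
      using sub set_take_subset[of i l] by blast
  qed
  then show ?thesis
    using linexts_first_occurrence_iff[OF l i] i
    by (simp add: label_word_def take_map image_image)
qed

text \<open>One kind of copy forms a chain, so its order is forced. After labelling, the first
  copies and the second copies each spell \<sigma>.\<close>

lemma linexts_filter_step:
  assumes l: "l \<in> linexts n"
  shows "filter (\<lambda>x. fst x = s) l = map (Pair s) [0..<n]"
proof -
  let ?k = "map snd (filter (\<lambda>x. fst x = s) l)"
  have "sorted_wrt (\<lambda>x y. \<not> grid_le y x) (filter (\<lambda>x. fst x = s) l)"
    using l by (simp add: linexts_def sorted_wrt_filter)
  then have "sorted_wrt (<) ?k"
    unfolding sorted_wrt_map
    by (rule sorted_wrt_mono_rel[rotated]) (cases s; auto simp: grid_le_def)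
  moreover have "set ?k = set [0..<n]"
    using linextsD(1)[OF l] by force
  ultimately have "?k = [0..<n]"
    by (intro strict_sorted_equal) auto
  then have "map (Pair s) [0..<n] = map (Pair s) ?k" by simp
  also have "\<dots> = filter (\<lambda>x. fst x = s) l"
    unfolding map_map by (rule map_idI) auto
  finally show ?thesis by simp
qed

lemma label_word_in_nonnesting_perms_over:
  assumes l: "l \<in> linexts n" and \<sigma>: "distinct \<sigma>" "set \<sigma> = {1..n}" "length \<sigma> = n"
  shows "label_word \<sigma> l \<in> nonnesting_perms_over n \<sigma>"
proof -
  let ?w = "label_word \<sigma> l"
  have len [simp]: "length ?w = length l" by (simp add: label_word_def)
  have filter_word: "map (\<lambda>x. \<sigma> ! snd x) (filter (\<lambda>x. fst x = s) l) = \<sigma>" for s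
    unfolding linexts_filter_step[OF l] using \<sigma> by (auto intro: nth_equalityI)
  have "mset l = mset (filter (\<lambda>x. fst x = East) l) + mset (filter (\<lambda>x. fst x = North) l)"
    using multiset_partition[of "mset l" "\<lambda>x. fst x = East"] by simp
  then have "mset ?w = mset \<sigma> + mset \<sigma>"
    unfolding label_word_def mset_map
    by (simp only: image_mset_union filter_word mset_map[symmetric])
  then have perm: "?w \<in> permutations_of_multiset (mset_set {1..n} + mset_set {1..n})"
    using \<sigma> mset_set_set[of \<sigma>] by (simp add: permutations_of_multiset_def)
  have idx: "snd (l ! i) < n" if "i < length l" for i
    using linextsD(1)[OF l] nth_mem[OF that] by (metis mem_Times_iff lessThan_iff)
  have same: "snd (l ! i) = snd (l ! j) \<and> fst (l ! i) = East \<and> fst (l ! j) = North"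
    if "i < j" "j < length l" "?w ! i = ?w ! j" for i j
  proof -
    have "snd (l ! i) = snd (l ! j)"
      using that idx[of i] idx[of j] \<sigma> by (simp add: label_word_def nth_eq_iff_index_eq)
    then show ?thesis
      using linextsD(2)[OF l that(1,2)] by (auto simp: grid_le_def)
  qed
  have "nonnesting ?w"
    unfolding nonnesting_def
  proof safe
    fix i j k m assume *: "i < j" "j < k" "k < m" "m < length ?w" "?w ! i = ?w ! m" "?w ! j = ?w ! k"
    \<comment> \<open>In a nested pattern the two \<open>East\<close> copies put the index at
      \<open>i\<close> below the index at \<open>j\<close>, while the two \<open>North\<close>
      copies demand the opposite.\<close>
    have "\<not> grid_le (l ! j) (l ! i)" "\<not> grid_le (l ! m) (l ! k)"
      using linextsD(2)[OF l] * by auto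
    then show False
      using same[of i m] same[of j k] * by (auto simp: grid_le_def)
  qed
  moreover have "first_copies ?w = nths ?w {i. i < length l \<and> fst (l ! i) = East}"
    unfolding first_copies_def nths_def
    using label_word_first_iff[OF l \<sigma>(1,3)]
    by (intro arg_cong[where f = "map fst"] filter_cong) (auto simp: set_zip)
  then have "first_copies ?w = \<sigma>"
    using filter_word[of East] by (simp add: label_word_def nths_map filter_eq_nths)
  ultimately show ?thesis
    using perm by (simp add: nonnesting_perms_over_def nonnesting_perms_def)
qed

section \<open>From words back to linear extensions\<close>

lemma first_copies_eq_filter:
  "first_copies w = map ((!) w) (filter (\<lambda>i. w ! i \<notin> set (take i w)) [0..<length w])"
proof -
  have "zip w [0..<length w] = map (\<lambda>i. (w ! i, i)) [0..<length w]"
    by (rule nth_equalityI) auto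
  then show ?thesis
    by (simp add: first_copies_def nths_def filter_map comp_def)
qed

lemma index_before_of_filter:
  assumes ij: "i < j" "j < m" "P i" "P j"
  obtains a b where "a < b" "b < length (filter P [0..<m])"
    "filter P [0..<m] ! a = i" "filter P [0..<m] ! b = j"
proof -
  let ?F = "filter P [0..<m]"
  have srt: "sorted_wrt (<) ?F" by (simp add: sorted_wrt_filter)
  have "i \<in> set ?F" "j \<in> set ?F" using ij by auto
  then obtain a b where ab: "a < length ?F" "?F ! a = i" "b < length ?F" "?F ! b = j"
    by (metis in_set_conv_nth)
  have "a < b"
    using sorted_wrt_nth_less[OF srt, of b a] ab ij by (cases a b rule: linorder_cases) auto
  then show ?thesis using that ab by blast
qed

text \<open>A first copy followed by a second copy is never out of order. In all other cases the
  index must increase: compare the first copies of the two letters, which occur in the order of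
  \<sigma>; for two second copies, nonnesting gives the order of the first ones.\<close>

lemma tag_word_in_linexts:
  assumes w: "w \<in> nonnesting_perms_over n \<sigma>" and \<sigma>: "distinct \<sigma>" "set \<sigma> = {1..n}" "length \<sigma> = n"
  shows "tag_word \<sigma> w \<in> linexts n"
proof (rule linextsI)
  define ix where "ix = inv_into {..<n} ((!) \<sigma>)"
  have ix_nth: "ix (\<sigma> ! a) = a" if "a < n" for a
    unfolding ix_def using \<sigma> that by (intro inv_into_f_f) (auto simp: inj_on_def nth_eq_iff_index_eq)
  have ix_less: "ix v < n" if "v \<in> {1..n}" for v
    using that \<sigma> ix_nth by (metis in_set_conv_nth)
  have ms: "mset w = mset_set {1..n} + mset_set {1..n}" and nn: "nonnesting w" and fc: "first_copies w = \<sigma>"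
    using w by (auto simp: nonnesting_perms_over_def nonnesting_perms_def permutations_of_multiset_def)
  have "length w = 2 * n"
    using arg_cong[OF ms, of size] by simp
  then show "length (tag_word \<sigma> w) = 2 * n"
    by (simp add: tag_word_def)
  have set_w: "set w = {1..n}"
    using arg_cong[OF ms, of set_mset] by simp
  then have in_range: "w ! i \<in> {1..n}" if "i < length w" for i
    using nth_mem[OF that] by simp
  show "set (tag_word \<sigma> w) \<subseteq> UNIV \<times> {..<n}"
    using ix_less in_range \<sigma>(3) by (auto simp: tag_word_def ix_def)
  define first where "first i \<longleftrightarrow> w ! i \<notin> set (take i w)" for i
  have first_iff: "first i \<longleftrightarrow> (\<forall>j<i. w ! j \<noteq> w ! i)" if "i < length w" for i
    using that by (auto simp: first_def in_set_conv_nth)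
  have ex_first: "\<exists>j\<le>i. w ! j = w ! i \<and> first j" if "i < length w" for i
  proof -
    define j where "j = (LEAST j. w ! j = w ! i)"
    have "w ! j = w ! i" "j \<le> i"
      unfolding j_def by (rule LeastI[of _ i], simp, rule Least_le, simp)
    moreover have "w ! k \<noteq> w ! i" if "k < j" for k
      using not_less_Least[of k "\<lambda>j. w ! j = w ! i"] that by (simp add: j_def)
    ultimately have "first j"
      using first_iff[of j] that by simp
    then show ?thesis
      using \<open>w ! j = w ! i\<close> \<open>j \<le> i\<close> by blast
  qed
  have first_order: "ix (w ! i) < ix (w ! j)" if "i < j" "j < length w" "first i" "first j" for i j
  proof -
    let ?F = "filter first [0..<length w]"
    have F: "\<sigma> = map ((!) w) ?F"
      using fc by (simp add: first_copies_eq_filter first_def[abs_def])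
    obtain a b where ab: "a < b" "b < length ?F" "?F ! a = i" "?F ! b = j"
      by (rule index_before_of_filter[of i j "length w" first, OF \<open>i < j\<close> \<open>j < length w\<close> \<open>first i\<close> \<open>first j\<close>])
    have "\<sigma> ! a = w ! i" "\<sigma> ! b = w ! j"
      using ab F by (metis length_map nth_map order.strict_trans)+
    moreover have "length ?F = n"
      using F \<sigma>(3) by (metis length_map)
    ultimately show ?thesis
      using ix_nth[of a] ix_nth[of b] ab by simp
  qed
  have not_three: False if "i < j" "j < k" "k < length w" "w ! i = w ! j" "w ! j = w ! k" for i j k
  proof -
    have "card {i, j, k} \<le> card {m. m < length w \<and> w ! m = w ! k}"
      using that by (intro card_mono) auto
    also have "\<dots> = count (mset w) (w ! k)"
      by (simp add: count_mset count_list_eq_length_filter length_filter_conv_card eq_commute)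
    also have "\<dots> \<le> 2"
      unfolding ms by (simp add: count_mset_set')
    finally show False
      using that by simp
  qed
  fix i j assume ij: "i < j" "j < length (tag_word \<sigma> w)"
  then have j: "j < length w" by (simp add: tag_word_def)
  obtain i' where i': "i' \<le> i" "w ! i' = w ! i" "first i'"
    using ex_first[of i] ij j by auto
  obtain j' where j': "j' \<le> j" "w ! j' = w ! j" "first j'"
    using ex_first[of j] j by auto
  have "ix (w ! i) < ix (w ! j)" if "\<not> (first i \<and> \<not> first j)"
  proof (cases "first j")
    case True
    then show ?thesis
      using first_order[of i' j] i' ij j by simp
  next
    case False
    then have "i' \<noteq> i" "j' \<noteq> j"
      using that i' j' by auto
    then have lt: "i' < i" "j' < j"
      using i' j' by auto
    \<comment> \<open>Equality would put one letter at the three positions \<open>i'\<close>,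
      \<open>i\<close> and \<open>j\<close>.\<close>
    have "j' \<noteq> i'"
      using not_three[of i' i j] lt ij j i' j' by auto
    \<comment> \<open>Otherwise \<open>j' < i' < i < j\<close> would be a nesting.\<close>
    moreover have "\<not> j' < i'"
      using nn lt ij j i' j' unfolding nonnesting_def by metis
    ultimately have "ix (w ! i') < ix (w ! j')"
      using first_order[of i' j'] i' j' lt j by simp
    then show ?thesis
      using i' j' by simp
  qed
  then show "\<not> grid_le (tag_word \<sigma> w ! j) (tag_word \<sigma> w ! i)"
    using ij j \<sigma>(3) by (auto simp: tag_word_def grid_le_def first_def ix_def split: if_splits)
qed

lemma label_word_tag_word:
  assumes "set w \<subseteq> set \<sigma>" shows "label_word \<sigma> (tag_word \<sigma> w) = w"
proof (rule nth_equalityI)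
  fix i assume "i < length (label_word \<sigma> (tag_word \<sigma> w))"
  then have i: "i < length w" by (simp add: label_word_def tag_word_def)
  then have "w ! i \<in> (!) \<sigma> ` {..<length \<sigma>}"
    using assms nth_mem[OF i] by (auto simp: set_conv_nth)
  then show "label_word \<sigma> (tag_word \<sigma> w) ! i = w ! i"
    using i by (simp add: label_word_def tag_word_def f_inv_into_f)
qed (simp add: label_word_def tag_word_def)

lemma tag_word_label_word:
  assumes l: "l \<in> linexts n" and \<sigma>: "distinct \<sigma>" "length \<sigma> = n"
  shows "tag_word \<sigma> (label_word \<sigma> l) = l"
proof (rule nth_equalityI)
  fix i assume "i < length (tag_word \<sigma> (label_word \<sigma> l))"
  then have i: "i < length l" by (simp add: label_word_def tag_word_def)
  have "snd (l ! i) < n"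
    using linextsD(1)[OF l] nth_mem[OF i] by (metis mem_Times_iff lessThan_iff)
  then have "inv_into {..<n} ((!) \<sigma>) (\<sigma> ! snd (l ! i)) = snd (l ! i)"
    using \<sigma> by (intro inv_into_f_f) (auto simp: inj_on_def nth_eq_iff_index_eq)
  moreover have "tag_word \<sigma> (label_word \<sigma> l) ! i
      = (if fst (l ! i) = North then North else East, inv_into {..<n} ((!) \<sigma>) (\<sigma> ! snd (l ! i)))"
    using i label_word_first_iff[OF l \<sigma> i] \<sigma> by (simp add: tag_word_def label_word_def)
  ultimately show "tag_word \<sigma> (label_word \<sigma> l) ! i = l ! i"
    by (cases "l ! i") (auto split: if_splits)
qed (simp add: label_word_def tag_word_def)

lemma C_gf_eq_linext_gf:
  assumes \<sigma>: "distinct \<sigma>" "set \<sigma> = {1..n}" "length \<sigma> = n"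
  shows "C_gf n \<sigma> t u = linext_gf n ((!) \<sigma>) t u"
  unfolding C_gf_def linext_gf_def
proof (rule sum.reindex_bij_witness[of _ "label_word \<sigma>" "tag_word \<sigma>"])
  fix w assume w: "w \<in> nonnesting_perms_over n \<sigma>"
  then have "mset w = mset_set {1..n} + mset_set {1..n}"
    by (simp add: nonnesting_perms_over_def nonnesting_perms_def permutations_of_multiset_def)
  from arg_cong[OF this, of set_mset] have "set w \<subseteq> set \<sigma>"
    using \<sigma> by simp
  then show eq: "label_word \<sigma> (tag_word \<sigma> w) = w"
    by (rule label_word_tag_word)
  show tag: "tag_word \<sigma> w \<in> linexts n"
    by (rule tag_word_in_linexts[OF w \<sigma>])
  have idx: "snd (tag_word \<sigma> w ! i) < n" if "i < length (tag_word \<sigma> w)" for i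
    using linextsD(1)[OF tag] nth_mem[OF that] by (metis mem_Times_iff lessThan_iff)
  have "des (label_word \<sigma> (tag_word \<sigma> w)) = consec (\<lambda>x y. \<sigma> ! snd x > \<sigma> ! snd y) (tag_word \<sigma> w)"
    unfolding des_def consec_def label_word_def by (intro arg_cong[where f = card]) auto
  \<comment> \<open>Distinctness of \<sigma> turns equal letters into equal indices.\<close>
  moreover have "plat (label_word \<sigma> (tag_word \<sigma> w)) = consec (\<lambda>x y. snd x = snd y) (tag_word \<sigma> w)"
    unfolding plat_def consec_def label_word_def using idx \<sigma>
    by (intro arg_cong[where f = card]) (auto simp: nth_eq_iff_index_eq)
  ultimately show "t ^ consec (\<lambda>x y. \<sigma> ! snd x > \<sigma> ! snd y) (tag_word \<sigma> w)
      * u ^ consec (\<lambda>x y. snd x = snd y) (tag_word \<sigma> w) = t ^ des w * u ^ plat w"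
    by (simp add: eq)
next
  fix l assume l: "l \<in> linexts n"
  show "tag_word \<sigma> (label_word \<sigma> l) = l" "label_word \<sigma> l \<in> nonnesting_perms_over n \<sigma>"
    using tag_word_label_word[OF l \<sigma>(1,3)] label_word_in_nonnesting_perms_over[OF l \<sigma>] by auto
qed

theorem theorem2p6:
  fixes n :: nat and \<sigma> :: "nat list" and t u :: "'a::comm_semiring_1"
  assumes "n \<ge> 1" and "\<sigma> \<in> permutations_of_set {1..n}"
  shows "C_gf n \<sigma> t u = t ^ des \<sigma> * N_gf n t u"
proof -
  have \<sigma>: "distinct \<sigma>" "set \<sigma> = {1..n}"
    using assms(2) by (auto simp: permutations_of_set_def)
  then have len: "length \<sigma> = n"
    using distinct_card[of \<sigma>] by simp
  have "inj_on ((!) \<sigma>) {..<n}"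
    using \<sigma> len by (auto simp: inj_on_def nth_eq_iff_index_eq)
  then show ?thesis
    by (simp add: C_gf_eq_linext_gf[OF \<sigma> len] N_gf_eq_linext_gf linext_gf_descents[of "(!) \<sigma>"]
        descents_def des_def len)
qed

end
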